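(* Let $m\ge2$, let $C=(c_{jk})$ be an $m\times m$ cost matrix, and let $L(j,q)$ be a proper scoring rule. Define $$\underline\psi(t)=\inf_{\substack{\eta',q'\in\Delta_m:\ \|\eta'-q'\|_{\infty2}=t,\\ \max_{j}q'_j\le1/2}}B_L(\eta',q'),\qquad t\ge0,$$ and the cost-transformed loss $\tilde L(j,q)=c_{jM}L(j,q)+\sum_{k\ne j}(c_{jM}-c_{jk})\{L(k,q)-1\}$ with $c_{jM}=\max_kc_{jk}$. Then for all $\eta,q\in\Delta_m$ the regrets of $L^{\mathrm{cw}}(j,q)$ and $\tilde L(j,q)$ satisfy $$\underline\psi\left(\frac{B^{\mathrm{cw}}(\eta,q)}{1_m^{T}\tilde\eta}\right)\le\frac{B_{\tilde L}(\eta,q)}{1_m^{T}\tilde\eta},$$ where $\tilde\eta=(\tilde\eta_1,\ldots,\tilde\eta_m)^{T}$ with $\tilde\eta_j=c_{jM}\eta_j+\sum_{k\ne j}(c_{kM}-c_{kj})\eta_k$.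
   Context: $\Delta_m=\{q\in\mathbb R^m: q_j\ge0,\ \sum_jq_j=1\}$; $1_m$ is the all-ones vector; $\|b\|_{\infty2}=\max_{j\ne k}(|b_j|+|b_k|)$. A cost matrix $C=(C_1,\ldots,C_m)$ (columns $C_k$) has $c_{jk}\ge0$, $c_{jj}=0$, and for each $j$, $c_{jk}>0$ for some $k\ne j$. A scoring rule is a loss $L(j,q)$, $j\in\{1,\dots,m\}$, with action space $\Delta_m$ and values in $(-\infty,\infty]$ (with $0\cdot\infty=0$), whose generalized entropy $H_L(\eta)=\inf_{q\in\Delta_m}\sum_j\eta_jL(j,q)$ is finite; it is proper if $H_L(\eta)=\sum_j\eta_jL(j,\eta)$ for all $\eta\in\Delta_m$. The regret is $B_L(\eta,q)=\sum_j\eta_jL(j,q)-H_L(\eta)$. The cost-weighted classification loss is $L^{\mathrm{cw}}(j,\gamma)=c_{jk}$ if $k=\mathrm{argmax}_l\gamma_l$, $\gamma\in\mathbb R^m$ (ties broken by any fixed rule), with regret $B^{\mathrm{cw}}(\eta,\gamma)=\sum_j\eta_jL^{\mathrm{cw}}(j,\gamma)-\min_k\eta^{T}C_k$. The infimum over an empty set is $+\infty$. *)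

theory Defs
  imports "HOL-Analysis.Analysis"
begin

definition prob_simplex :: "(real ^ 'm) set" where
  "prob_simplex = {q. (\<forall>j. 0 \<le> q $ j) \<and> (\<Sum>j\<in>UNIV. q $ j) = 1}"

definition norm_inf2 :: "real ^ 'm \<Rightarrow> real" where
  "norm_inf2 b = Max {\<bar>b $ j\<bar> + \<bar>b $ k\<bar> | j k. j \<noteq> k}"

text \<open>The entry \<open>C $ j $ k\<close> is the cost of deciding for class \<open>k\<close> when the true class is \<open>j\<close>.\<close>

definition cost_matrix :: "real ^ 'm ^ 'm \<Rightarrow> bool" where
  "cost_matrix C \<longleftrightarrow>
     (\<forall>j k. 0 \<le> C $ j $ k) \<and> (\<forall>j. C $ j $ j = 0) \<and> (\<forall>j. \<exists>k. k \<noteq> j \<and> 0 < C $ j $ k)"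

definition max_cost :: "real ^ 'm ^ 'm \<Rightarrow> 'm \<Rightarrow> real" where
  "max_cost C j = Max (range (\<lambda>k. C $ j $ k))"

text \<open>Losses take values in \<open>ereal\<close>, whose multiplication satisfies \<open>0 * \<infinity> = 0\<close>. Only their
  values at actions in the probability simplex matter.\<close>

definition risk :: "('m \<Rightarrow> real ^ 'm \<Rightarrow> ereal) \<Rightarrow> real ^ 'm \<Rightarrow> real ^ 'm \<Rightarrow> ereal" where
  "risk L \<eta> q = (\<Sum>j\<in>UNIV. ereal (\<eta> $ j) * L j q)"

definition entropy :: "('m \<Rightarrow> real ^ 'm \<Rightarrow> ereal) \<Rightarrow> real ^ 'm \<Rightarrow> ereal" where
  "entropy L \<eta> = (INF q\<in>prob_simplex. risk L \<eta> q)"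

definition regret :: "('m \<Rightarrow> real ^ 'm \<Rightarrow> ereal) \<Rightarrow> real ^ 'm \<Rightarrow> real ^ 'm \<Rightarrow> ereal" where
  "regret L \<eta> q = risk L \<eta> q - entropy L \<eta>"

definition scoring_rule :: "('m \<Rightarrow> real ^ 'm \<Rightarrow> ereal) \<Rightarrow> bool" where
  "scoring_rule L \<longleftrightarrow>
     (\<forall>j. \<forall>q\<in>prob_simplex. L j q \<noteq> -\<infinity>) \<and>
     (\<forall>\<eta>\<in>prob_simplex. \<bar>entropy L \<eta>\<bar> \<noteq> \<infinity>)"

definition proper_scoring_rule :: "('m \<Rightarrow> real ^ 'm \<Rightarrow> ereal) \<Rightarrow> bool" where
  "proper_scoring_rule L \<longleftrightarrow>
     scoring_rule L \<and> (\<forall>\<eta>\<in>prob_simplex. entropy L \<eta> = risk L \<eta> \<eta>)"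

text \<open>A tie-breaking rule is a function selecting, for every \<open>\<gamma>\<close>, one of the maximizing indices.\<close>

definition argmax_rule :: "(real ^ 'm \<Rightarrow> 'm) \<Rightarrow> bool" where
  "argmax_rule am \<longleftrightarrow> (\<forall>\<gamma> l. \<gamma> $ l \<le> \<gamma> $ am \<gamma>)"

definition cw_loss :: "real ^ 'm ^ 'm \<Rightarrow> (real ^ 'm \<Rightarrow> 'm) \<Rightarrow> 'm \<Rightarrow> real ^ 'm \<Rightarrow> real" where
  "cw_loss C am j \<gamma> = C $ j $ am \<gamma>"

definition cw_regret ::
    "real ^ 'm ^ 'm \<Rightarrow> (real ^ 'm \<Rightarrow> 'm) \<Rightarrow> real ^ 'm \<Rightarrow> real ^ 'm \<Rightarrow> real" where
  "cw_regret C am \<eta> \<gamma> =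
     (\<Sum>j\<in>UNIV. \<eta> $ j * cw_loss C am j \<gamma>) - Min (range (\<lambda>k. \<eta> \<bullet> column k C))"

definition cost_transformed_loss ::
    "real ^ 'm ^ 'm \<Rightarrow> ('m \<Rightarrow> real ^ 'm \<Rightarrow> ereal) \<Rightarrow> 'm \<Rightarrow> real ^ 'm \<Rightarrow> ereal" where
  "cost_transformed_loss C L j q =
     ereal (max_cost C j) * L j q +
     (\<Sum>k\<in>UNIV - {j}. ereal (max_cost C j - C $ j $ k) * (L k q - 1))"

definition cost_transformed_vec :: "real ^ 'm ^ 'm \<Rightarrow> real ^ 'm \<Rightarrow> real ^ 'm" where
  "cost_transformed_vec C \<eta> =
     (\<chi> j. max_cost C j * \<eta> $ j + (\<Sum>k\<in>UNIV - {j}. (max_cost C k - C $ k $ j) * \<eta> $ k))"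

text \<open>The infimum is taken in \<open>ereal\<close>, so it is \<open>\<infinity>\<close> when no pair is admissible.\<close>

definition psi_lower :: "('m \<Rightarrow> real ^ 'm \<Rightarrow> ereal) \<Rightarrow> real \<Rightarrow> ereal" where
  "psi_lower L t =
     Inf {regret L \<eta>' q' | \<eta>' q'.
            \<eta>' \<in> prob_simplex \<and> q' \<in> prob_simplex \<and>
            norm_inf2 (\<eta>' - q') = t \<and> Max (range (\<lambda>j. q' $ j)) \<le> 1 / 2}"

end

theory Submission
  imports Defs
begin

text \<open>
  With \<open>S = 1\<^sup>T \<eta>~\<close> and \<open>\<eta>* = \<eta>~ / S\<close>, the transformed risk at \<open>\<eta>\<close> is \<open>S\<close> times the risk of \<open>L\<close>
  at \<open>\<eta>*\<close> up to a constant, and the cost-weighted regret is \<open>S\<close> times the zero-one regret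
  \<open>max \<eta>* - \<eta>*\<^sub>k\<close>, where \<open>k\<close> is the decision at \<open>q\<close>. This reduces the claim to zero-one loss.
  There, the regret of a proper rule decreases when either argument moves towards the other
  along a segment. Let \<open>j\<close> maximize \<open>\<eta>*\<close>. First \<open>q\<close> is moved towards \<open>\<eta>*\<close> to the point where
  coordinates \<open>j\<close> and \<open>k\<close> agree, which forces all coordinates to be at most \<open>1/2\<close>; then
  \<open>\<eta>*\<close> is moved towards that point until the distance is exactly the zero-one regret.
\<close>

section \<open>Linearity of the risk in the class weights\<close>

lemma ereal_sum_distrib_left:
  fixes f :: "'b \<Rightarrow> ereal"
  assumes "finite A" "0 \<le> c"
  shows "ereal c * sum f A = (\<Sum>j\<in>A. ereal c * f j)"
  using assms(1) by induction (use assms(2) in \<open>simp_all add: ereal_pos_distrib\<close>)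

text \<open>Losses may be infinite, so distributivity in \<open>ereal\<close> relies on all weights
  being nonnegative. \<open>x\<close> and \<open>y\<close> need not be normalized, which later
  allows unnormalized class weights.\<close>

lemma risk_combine:
  assumes "0 \<le> a" "0 \<le> b" "\<And>j. 0 \<le> x $ j" "\<And>j. 0 \<le> y $ j"
  shows "risk L (a *\<^sub>R x + b *\<^sub>R y) q = ereal a * risk L x q + ereal b * risk L y q"
proof -
  have "ereal ((a *\<^sub>R x + b *\<^sub>R y) $ j) * l
      = ereal a * (ereal (x $ j) * l) + ereal b * (ereal (y $ j) * l)" for j l
  proof -
    have "ereal ((a *\<^sub>R x + b *\<^sub>R y) $ j) = ereal (a * x $ j) + ereal (b * y $ j)" by simp
    then have "ereal ((a *\<^sub>R x + b *\<^sub>R y) $ j) * l = ereal (a * x $ j) * l + ereal (b * y $ j) * l"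
      using assms by (simp only: ereal_left_distrib ereal_less_eq mult_nonneg_nonneg zero_ereal_def)
    then show ?thesis by (simp only: times_ereal.simps(1)[symmetric] mult.assoc)
  qed
  then show ?thesis
    using assms by (simp add: risk_def ereal_sum_distrib_left sum.distrib)
qed

lemma prob_simplex_segment:
  assumes "x \<in> prob_simplex" "y \<in> prob_simplex" "0 \<le> u" "u \<le> 1"
  shows "(1 - u) *\<^sub>R x + u *\<^sub>R y \<in> prob_simplex"
  using assms by (auto simp: prob_simplex_def sum.distrib sum_distrib_left[symmetric])

section \<open>Monotonicity of proper regrets along segments\<close>

lemma proper_risk_le:
  assumes "proper_scoring_rule L" "\<eta> \<in> prob_simplex" "q \<in> prob_simplex"
  shows "risk L \<eta> \<eta> \<le> risk L \<eta> q"
  using assms unfolding proper_scoring_rule_def entropy_def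
  by (metis INF_lower)

lemma proper_risk_real:
  assumes "proper_scoring_rule L" "\<eta> \<in> prob_simplex"
  obtains r where "risk L \<eta> \<eta> = ereal r"
  using assms unfolding proper_scoring_rule_def scoring_rule_def
  by (metis ereal_real)

lemma proper_regret:
  assumes "proper_scoring_rule L" "\<eta> \<in> prob_simplex"
  shows "regret L \<eta> q = risk L \<eta> q - risk L \<eta> \<eta>"
  using assms by (simp add: proper_scoring_rule_def regret_def)

lemma regret_segment_right:
  assumes L: "proper_scoring_rule L" and \<eta>: "\<eta> \<in> prob_simplex" and q: "q \<in> prob_simplex"
    and u: "0 \<le> u" "u \<le> 1"
  shows "regret L \<eta> ((1 - u) *\<^sub>R \<eta> + u *\<^sub>R q) \<le> regret L \<eta> q"
proof (cases "u = 0 \<or> u = 1 \<or> risk L \<eta> q = \<infinity>")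
  case True
  obtain r where "risk L \<eta> \<eta> = ereal r" using proper_risk_real[OF L \<eta>] .
  with True proper_risk_le[OF L \<eta> q] show ?thesis
    by (cases "risk L \<eta> q") (auto simp: proper_regret[OF L \<eta>])
next
  case False
  define p where "p = (1 - u) *\<^sub>R \<eta> + u *\<^sub>R q"
  have u': "0 < u" "0 < 1 - u" using False u by auto
  have p: "p \<in> prob_simplex"
    unfolding p_def by (rule prob_simplex_segment[OF \<eta> q u])
  have comb: "risk L p z = ereal (1 - u) * risk L \<eta> z + ereal u * risk L q z" for z
    unfolding p_def using \<eta> q u by (intro risk_combine) (auto simp: prob_simplex_def)
  obtain rh where rh: "risk L \<eta> \<eta> = ereal rh" using proper_risk_real[OF L \<eta>] .
  obtain rq where rq: "risk L q q = ereal rq" using proper_risk_real[OF L q] .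
  obtain rp where rp: "risk L p p = ereal rp" using proper_risk_real[OF L p] .
  obtain h where h: "risk L \<eta> q = ereal h"
    using False proper_risk_le[OF L \<eta> q] rh by (cases "risk L \<eta> q") auto
  \<comment> \<open>Both risks enter the finite \<open>risk L p p\<close> with positive weight and
    neither is \<open>-\<infinity>\<close>, so both are finite and can be cancelled.\<close>
  obtain a b where a: "risk L \<eta> p = ereal a" and b: "risk L q p = ereal b"
    using comb[of p] rp u' rh rq proper_risk_le[OF L \<eta> p] proper_risk_le[OF L q p]
    by (cases "risk L \<eta> p"; cases "risk L q p") auto
  have "rp = (1 - u) * a + u * b" using comb[of p] rp a b by simp
  moreover have "rp \<le> (1 - u) * h + u * rq"
    using comb[of q] proper_risk_le[OF L p q] rp h rq by simp
  moreover have "u * rq \<le> u * b"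
    using proper_risk_le[OF L q p] rq b u' by simp
  ultimately have "(1 - u) * a \<le> (1 - u) * h" by linarith
  then have "a \<le> h" using u' by simp
  then show ?thesis
    using a h rh by (simp add: proper_regret[OF L \<eta>] flip: p_def)
qed

text \<open>The risk of \<open>q\<close> is affine along the segment and the entropy is concave, so
  the regret of \<open>q\<close> is convex. It vanishes at \<open>q\<close>, hence the intermediate
  regret is at most \<open>u\<close> times the regret at \<eta>.\<close>

lemma regret_segment_left:
  assumes L: "proper_scoring_rule L" and \<eta>: "\<eta> \<in> prob_simplex" and q: "q \<in> prob_simplex"
    and u: "0 \<le> u" "u \<le> 1"
  shows "regret L ((1 - u) *\<^sub>R q + u *\<^sub>R \<eta>) q \<le> regret L \<eta> q"
proof -
  define p where "p = (1 - u) *\<^sub>R q + u *\<^sub>R \<eta>"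
  have p: "p \<in> prob_simplex"
    unfolding p_def by (rule prob_simplex_segment[OF q \<eta> u])
  have comb: "risk L p z = ereal (1 - u) * risk L q z + ereal u * risk L \<eta> z" for z
    unfolding p_def using \<eta> q u by (intro risk_combine) (auto simp: prob_simplex_def)
  obtain rh where rh: "risk L \<eta> \<eta> = ereal rh" using proper_risk_real[OF L \<eta>] .
  obtain rq where rq: "risk L q q = ereal rq" using proper_risk_real[OF L q] .
  obtain rp where rp: "risk L p p = ereal rp" using proper_risk_real[OF L p] .
  show ?thesis
  proof (cases "risk L \<eta> q")
    case (real h)
    have "regret L p q \<le> regret L \<eta> q"
    proof -
      \<comment> \<open>The computation stays in \<open>ereal\<close>: at \<open>u = 1\<close> the
        value \<open>risk L q p\<close> may be infinite, with weight 0.\<close>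
      have "ereal u * risk L \<eta> p + ereal (1 - u) * risk L q p = ereal rp"
        using comb[of p] rp by (simp add: add.commute)
      moreover have "ereal (1 - u) * ereal rq \<le> ereal (1 - u) * risk L q p"
        using proper_risk_le[OF L q p] rq u by (metis diff_ge_0_iff_ge ereal_less_eq(5) ereal_mult_left_mono)
      moreover have "ereal u * ereal rh \<le> ereal u * risk L \<eta> p"
        using proper_risk_le[OF L \<eta> p] rh u by (metis ereal_less_eq(5) ereal_mult_left_mono)
      ultimately have "ereal u * ereal rh + ereal (1 - u) * ereal rq \<le> ereal rp"
        by (metis add_mono)
      then have "u * rh + (1 - u) * rq \<le> rp" by simp
      moreover have "risk L p q = ereal ((1 - u) * rq + u * h)"
        using comb[of q] rq real by simp
      moreover have "u * (h - rh) \<le> h - rh"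
        using proper_risk_le[OF L \<eta> q] rh real u by (intro mult_left_le_one_le) auto
      ultimately show ?thesis
        using rh rp real
        by (simp add: proper_regret[OF L \<eta>] proper_regret[OF L p] algebra_simps)
    qed
    then show ?thesis by (simp add: p_def)
  qed (use rh proper_risk_le[OF L \<eta> q] in \<open>simp_all add: proper_regret[OF L \<eta>]\<close>)
qed

section \<open>The norm, the function \<open>psi_lower\<close> and the zero-one case\<close>

lemma finite_inf2_set: "finite {\<bar>b $ j\<bar> + \<bar>b $ k\<bar> | j k. j \<noteq> (k :: 'm :: finite)}"
proof -
  have "{\<bar>b $ j\<bar> + \<bar>b $ k\<bar> | j k. j \<noteq> k} \<subseteq> (\<lambda>(j, k). \<bar>b $ j\<bar> + \<bar>b $ k\<bar>) ` UNIV"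
    by auto
  then show ?thesis by (rule finite_subset) simp
qed

lemma norm_inf2_ge: "j \<noteq> k \<Longrightarrow> \<bar>b $ j\<bar> + \<bar>b $ k\<bar> \<le> norm_inf2 b"
  unfolding norm_inf2_def by (rule Max_ge[OF finite_inf2_set]) auto

lemma norm_inf2_scale:
  fixes b :: "real ^ 'm"
  assumes "j \<noteq> (k :: 'm)" "0 \<le> c"
  shows "norm_inf2 (c *\<^sub>R b) = c * norm_inf2 b"
proof -
  have "mono ((*) c)" using assms by (simp add: mono_def mult_left_mono)
  moreover have "{\<bar>b $ j\<bar> + \<bar>b $ k\<bar> | j k. j \<noteq> k} \<noteq> {}" using assms by auto
  ultimately have "c * norm_inf2 b = Max ((*) c ` {\<bar>b $ j\<bar> + \<bar>b $ k\<bar> | j k. j \<noteq> k})"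
    unfolding norm_inf2_def by (intro mono_Max_commute finite_inf2_set)
  also have "(*) c ` {\<bar>b $ j\<bar> + \<bar>b $ k\<bar> | j k. j \<noteq> k}
      = {\<bar>(c *\<^sub>R b) $ j\<bar> + \<bar>(c *\<^sub>R b) $ k\<bar> | j k. j \<noteq> k}"
    using assms by (force simp: abs_mult distrib_left)
  finally show ?thesis by (simp add: norm_inf2_def)
qed

lemma psi_lower_le_regret:
  assumes "\<eta> \<in> prob_simplex" "q \<in> prob_simplex" "norm_inf2 (\<eta> - q) = t" "\<And>j. q $ j \<le> 1 / 2"
  shows "psi_lower L t \<le> regret L \<eta> q"
proof -
  have "Max (range (($) q)) \<le> 1 / 2"
    by (rule Max.boundedI) (use assms(4) in auto)
  then show ?thesis unfolding psi_lower_def using assms(1-3) by (intro Inf_lower) blast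
qed

text \<open>The uniform distribution paired with itself is admissible at distance 0, since its
  entries are at most 1/2 when there are at least two classes. Its regret is 0.\<close>

lemma psi_lower_0_le:
  fixes L :: "'m \<Rightarrow> real ^ 'm \<Rightarrow> ereal"
  assumes card: "CARD('m) \<ge> 2" and L: "proper_scoring_rule L"
    and "\<eta> \<in> prob_simplex" "q \<in> prob_simplex"
  shows "psi_lower L 0 \<le> regret L \<eta> q"
proof -
  define w :: "real ^ 'm" where "w = (\<chi> j. 1 / real CARD('m))"
  have w: "w \<in> prob_simplex" by (simp add: prob_simplex_def w_def)
  obtain j k :: 'm where "j \<noteq> k"
    using card by (metis card_2_iff' ex_card)
  then have "norm_inf2 (w - w) = 0"
    using norm_inf2_scale[of j k 0 w] by simp
  then have "psi_lower L 0 \<le> regret L w w"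
    using card by (intro psi_lower_le_regret w) (auto simp: w_def field_simps)
  also have "\<dots> = 0"
    using proper_risk_real[OF L w] by (metis proper_regret[OF L w] ereal_minus(1) diff_self zero_ereal_def)
  also have "0 \<le> regret L \<eta> q"
    using proper_risk_le[OF L assms(3,4)] proper_risk_real[OF L assms(3)]
    by (metis proper_regret[OF L assms(3)] ereal_diff_positive)
  finally show ?thesis .
qed

lemma prob_simplex_two_le:
  fixes p :: "real ^ 'm"
  assumes "p \<in> prob_simplex" "i \<noteq> l"
  shows "p $ i + p $ l \<le> 1"
proof -
  have "sum (($) p) {i, l} \<le> sum (($) p) UNIV"
    using assms by (intro sum_mono2) (auto simp: prob_simplex_def)
  then show ?thesis using assms by (simp add: prob_simplex_def)
qed

lemma psi_lower_zero_one:
  fixes L :: "'m \<Rightarrow> real ^ 'm \<Rightarrow> ereal"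
  assumes card: "CARD('m) \<ge> 2" and L: "proper_scoring_rule L"
    and \<eta>: "\<eta> \<in> prob_simplex" and q: "q \<in> prob_simplex"
    and j: "\<And>l. \<eta> $ l \<le> \<eta> $ j" and k: "\<And>l. q $ l \<le> q $ k"
  shows "psi_lower L (\<eta> $ j - \<eta> $ k) \<le> regret L \<eta> q"
proof (cases "\<eta> $ j = \<eta> $ k")
  case True
  then show ?thesis using psi_lower_0_le[OF card L \<eta> q] by simp
next
  case False
  define t where "t = \<eta> $ j - \<eta> $ k"
  have t: "0 < t" using False j[of k] by (simp add: t_def)
  have jk: "j \<noteq> k" using False by auto
  \<comment> \<open>Along the segment from \<eta> to \<open>q\<close>, the gap between coordinates
    \<open>j\<close> and \<open>k\<close> goes from \<open>t\<close> to \<open>t - d\<close>, so it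
    vanishes at \<open>u = t / d\<close>.\<close>
  define d where "d = t + (q $ k - q $ j)"
  have d: "t \<le> d" "0 < d" using t k[of j] by (auto simp: d_def)
  define u where "u = t / d"
  have u: "0 \<le> u" "u \<le> 1" using t d by (auto simp: u_def)
  define p where "p = (1 - u) *\<^sub>R \<eta> + u *\<^sub>R q"
  have p: "p \<in> prob_simplex"
    unfolding p_def by (rule prob_simplex_segment[OF \<eta> q u])
  have "u * d = t" using d by (simp add: u_def)
  then have pjk: "p $ j = p $ k"
    by (simp add: p_def d_def t_def algebra_simps)
  \<comment> \<open>The equal coordinates \<open>j\<close> and \<open>k\<close> sum to at most 1.
    Any other coordinate is dominated by \<open>j\<close> in \<eta> and by \<open>k\<close> in
    \<open>q\<close>, so it is at most 1/2 in both.\<close>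
  have half: "p $ l \<le> 1 / 2" for l
  proof (cases "l = j \<or> l = k")
    case True
    then show ?thesis using prob_simplex_two_le[OF p jk] pjk by auto
  next
    case False
    have "\<eta> $ l \<le> 1 / 2" using prob_simplex_two_le[OF \<eta>, of l j] j[of l] False by auto
    moreover have "q $ l \<le> 1 / 2" using prob_simplex_two_le[OF q, of l k] k[of l] False by auto
    ultimately have "(1 - u) * \<eta> $ l + u * q $ l \<le> (1 - u) * (1 / 2) + u * (1 / 2)"
      using u by (intro add_mono mult_left_mono) auto
    then show ?thesis by (simp add: p_def field_simps)
  qed
  define N where "N = norm_inf2 (\<eta> - p)"
  \<comment> \<open>Since \<open>p\<close> agrees at \<open>j\<close> and \<open>k\<close>, the
    differences of \<eta> and \<open>p\<close> there differ by exactly \<open>t\<close>, which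
    bounds the sum of their absolute values from below.\<close>
  have N: "t \<le> N"
    using norm_inf2_ge[OF jk, of "\<eta> - p"] pjk by (simp add: N_def t_def)
  define v where "v = t / N"
  have v: "0 \<le> v" "v \<le> 1" using t N by (auto simp: v_def)
  define e where "e = (1 - v) *\<^sub>R p + v *\<^sub>R \<eta>"
  have "e - p = v *\<^sub>R (\<eta> - p)" by (simp add: e_def algebra_simps)
  then have "norm_inf2 (e - p) = t"
    using norm_inf2_scale[OF jk v(1), of "\<eta> - p"] t N by (simp add: v_def N_def)
  then have "psi_lower L t \<le> regret L e p"
    using half unfolding e_def
    by (intro psi_lower_le_regret prob_simplex_segment p \<eta> v) auto
  also have "\<dots> \<le> regret L \<eta> p"
    unfolding e_def by (rule regret_segment_left[OF L \<eta> p v])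
  also have "\<dots> \<le> regret L \<eta> q"
    unfolding p_def by (rule regret_segment_right[OF L \<eta> q u])
  finally show ?thesis by (simp add: t_def)
qed

section \<open>Reduction of the cost-weighted problem to zero-one loss\<close>

lemma max_cost_ge: "C $ j $ k \<le> max_cost C j"
  unfolding max_cost_def by (rule Max_ge) auto

text \<open>As the diagonal costs vanish, the leading term is the diagonal summand of one uniform
  sum.\<close>

lemma cost_transformed_vec_nth:
  assumes "cost_matrix C"
  shows "cost_transformed_vec C \<eta> $ j = (\<Sum>i\<in>UNIV. \<eta> $ i * (max_cost C i - C $ i $ j))"
  using assms unfolding cost_transformed_vec_def cost_matrix_def
  by (simp add: sum.remove[of UNIV j] mult.commute)

lemma cost_transformed_vec_nonneg:
  assumes "cost_matrix C" "\<eta> \<in> prob_simplex"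
  shows "0 \<le> cost_transformed_vec C \<eta> $ j"
  using assms max_cost_ge[of C]
  by (auto simp: cost_transformed_vec_nth prob_simplex_def intro!: sum_nonneg)

text \<open>A class \<open>i\<close> of positive probability contributes \<open>max_cost C i\<close>
  times that probability to its own coordinate, and this maximal cost is positive.\<close>

lemma cost_transformed_vec_sum_pos:
  assumes C: "cost_matrix C" and \<eta>: "\<eta> \<in> prob_simplex"
  shows "0 < (\<Sum>j\<in>UNIV. cost_transformed_vec C \<eta> $ j)"
proof -
  obtain i where i: "0 < \<eta> $ i"
    using \<eta> unfolding prob_simplex_def
    by (smt (verit) mem_Collect_eq sum_nonpos)
  obtain k where "0 < C $ i $ k" using C unfolding cost_matrix_def by blast
  then have "0 < max_cost C i" using max_cost_ge[of C i k] by linarith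
  then have "0 < \<eta> $ i * (max_cost C i - C $ i $ i)"
    using i C by (simp add: cost_matrix_def)
  also have "\<dots> \<le> (\<Sum>l\<in>UNIV. \<eta> $ l * (max_cost C l - C $ l $ i))"
    using \<eta> max_cost_ge[of C]
    by (intro member_le_sum[where f = "\<lambda>l. \<eta> $ l * (max_cost C l - C $ l $ i)"])
       (auto simp: prob_simplex_def)
  also have "\<dots> = cost_transformed_vec C \<eta> $ i"
    by (simp add: cost_transformed_vec_nth[OF C])
  also have "\<dots> \<le> (\<Sum>j\<in>UNIV. cost_transformed_vec C \<eta> $ j)"
    using cost_transformed_vec_nonneg[OF C \<eta>] by (intro member_le_sum) auto
  finally show ?thesis .
qed

text \<open>The expected cost of decision \<open>l\<close> is a constant minus coordinate
  \<open>l\<close> of the transformed vector, so the cheapest decision maximizes that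
  vector.\<close>

lemma cw_regret_eq:
  assumes C: "cost_matrix C"
    and j: "\<And>l. cost_transformed_vec C \<eta> $ l \<le> cost_transformed_vec C \<eta> $ j"
  shows "cw_regret C am \<eta> q
    = cost_transformed_vec C \<eta> $ j - cost_transformed_vec C \<eta> $ am q"
proof -
  define K where "K = (\<Sum>i\<in>UNIV. \<eta> $ i * max_cost C i)"
  have col: "\<eta> \<bullet> column l C = K - cost_transformed_vec C \<eta> $ l" for l
    by (simp add: cost_transformed_vec_nth[OF C] inner_vec_def column_def K_def
        right_diff_distrib sum_subtractf)
  have "Min (range (\<lambda>l. \<eta> \<bullet> column l C)) = \<eta> \<bullet> column j C"
    using j by (intro Min_eqI) (auto simp: col)
  moreover have "(\<Sum>i\<in>UNIV. \<eta> $ i * cw_loss C am i q) = \<eta> \<bullet> column (am q) C"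
    by (simp add: inner_vec_def column_def cw_loss_def)
  ultimately show ?thesis by (simp add: cw_regret_def col)
qed

text \<open>The transformed loss applies the nonnegative matrix \<open>D\<close> to the losses
  \<open>L k q\<close>, up to a constant for each class. Exchanging the two sums moves
  \<open>D\<close> onto \<eta>, which yields the transformed vector.\<close>

lemma risk_cost_transformed:
  assumes C: "cost_matrix C" and \<eta>: "\<eta> \<in> prob_simplex"
  defines "K \<equiv> (\<Sum>j\<in>UNIV. \<eta> $ j * (\<Sum>k\<in>UNIV - {j}. max_cost C j - C $ j $ k))"
  shows "risk (cost_transformed_loss C L) \<eta> q
    = risk L (cost_transformed_vec C \<eta>) q + ereal (- K)"
proof -
  define D where "D j k = max_cost C j - C $ j $ k" for j k
  have D: "0 \<le> D j k" for j k using max_cost_ge[of C j k] by (simp add: D_def)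
  have h: "0 \<le> \<eta> $ j" for j using \<eta> by (simp add: prob_simplex_def)
  have loss: "cost_transformed_loss C L j q
      = (\<Sum>k\<in>UNIV. ereal (D j k) * L k q) + ereal (- (\<Sum>k\<in>UNIV - {j}. D j k))" for j
  proof -
    have "ereal (D j k) * (L k q - 1) = ereal (D j k) * L k q + ereal (- D j k)" for k
    proof -
      have "ereal (D j k) * (L k q - 1) = ereal (D j k) * (L k q + ereal (- 1))"
        by (simp add: minus_ereal_def one_ereal_def)
      then show ?thesis
        using D by (simp add: ereal_pos_distrib)
    qed
    moreover have "D j j = max_cost C j" using C by (simp add: D_def cost_matrix_def)
    ultimately show ?thesis
      by (simp add: cost_transformed_loss_def sum.distrib sum.remove[of UNIV j] sum_negf add.assoc
          flip: D_def)
  qed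
  have "risk (cost_transformed_loss C L) \<eta> q
      = (\<Sum>j\<in>UNIV. (\<Sum>k\<in>UNIV. ereal (\<eta> $ j) * (ereal (D j k) * L k q))
           + ereal (\<eta> $ j * - (\<Sum>k\<in>UNIV - {j}. D j k)))"
    unfolding risk_def loss
    by (intro sum.cong refl) (simp add: ereal_pos_distrib ereal_sum_distrib_left h)
  also have "\<dots> = (\<Sum>k\<in>UNIV. \<Sum>j\<in>UNIV. ereal (\<eta> $ j) * (ereal (D j k) * L k q)) + ereal (- K)"
    by (subst sum.swap[where g = "\<lambda>k j. ereal (\<eta> $ j) * (ereal (D j k) * L k q)"])
      (simp add: sum.distrib K_def D_def sum_negf)
  also have "(\<Sum>k\<in>UNIV. \<Sum>j\<in>UNIV. ereal (\<eta> $ j) * (ereal (D j k) * L k q))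
      = risk L (cost_transformed_vec C \<eta>) q"
    unfolding risk_def
  proof (intro sum.cong refl)
    fix k
    have "(\<Sum>j\<in>UNIV. ereal (\<eta> $ j) * (ereal (D j k) * L k q))
        = (\<Sum>j\<in>UNIV. ereal (\<eta> $ j * D j k) * L k q)"
      by (simp add: mult.assoc flip: times_ereal.simps(1))
    also have "\<dots> = (\<Sum>j\<in>UNIV. ereal (\<eta> $ j * D j k)) * L k q"
      using h D by (intro sum_ereal_left_distrib[symmetric]) simp
    finally show "(\<Sum>j\<in>UNIV. ereal (\<eta> $ j) * (ereal (D j k) * L k q))
        = ereal (cost_transformed_vec C \<eta> $ k) * L k q"
      by (simp add: cost_transformed_vec_nth[OF C] D_def)
  qed
  finally show ?thesis .
qed

lemma regret_cost_transformed:
  assumes C: "cost_matrix C" and \<eta>: "\<eta> \<in> prob_simplex" and q: "q \<in> prob_simplex"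
    and L: "proper_scoring_rule L"
    and S: "0 < S" and e: "e \<in> prob_simplex" and eq: "cost_transformed_vec C \<eta> = S *\<^sub>R e"
  shows "regret (cost_transformed_loss C L) \<eta> q = ereal S * regret L e q"
proof -
  obtain K where K: "risk (cost_transformed_loss C L) \<eta> z = ereal S * risk L e z + ereal K" for z
  proof -
    have "risk L (S *\<^sub>R e) z = ereal S * risk L e z" for z
      using risk_combine[of S 0 e e L z] S e by (simp add: prob_simplex_def flip: zero_ereal_def)
    then show ?thesis
      using risk_cost_transformed[OF C \<eta>, of L] eq that by simp
  qed
  \<comment> \<open>The transformed risk at \<eta> is an increasing function of
    \<open>risk L e z\<close>, so propriety makes \<open>e\<close>, rather than \<eta>, a
    minimizer.\<close>
  have "entropy (cost_transformed_loss C L) \<eta> = ereal S * risk L e e + ereal K"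
    unfolding entropy_def K
  proof (rule antisym)
    show "(INF z\<in>prob_simplex. ereal S * risk L e z + ereal K) \<le> ereal S * risk L e e + ereal K"
      by (rule INF_lower[OF e])
    show "ereal S * risk L e e + ereal K \<le> (INF z\<in>prob_simplex. ereal S * risk L e z + ereal K)"
      using S by (intro INF_greatest add_right_mono ereal_mult_left_mono proper_risk_le[OF L e]) auto
  qed
  moreover obtain r where "risk L e e = ereal r" using proper_risk_real[OF L e] .
  ultimately show ?thesis
    using S by (cases "risk L e q")
      (simp_all add: regret_def[of "cost_transformed_loss C L"] K proper_regret[OF L e] algebra_simps)
qed

theorem corollary2:
  fixes C :: "real ^ 'm ^ 'm"
    and L :: "'m \<Rightarrow> real ^ 'm \<Rightarrow> ereal"
    and am :: "real ^ 'm \<Rightarrow> 'm"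
    and \<eta> q :: "real ^ 'm"
  assumes "CARD('m) \<ge> 2"
    and "cost_matrix C"
    and "proper_scoring_rule L"
    and "argmax_rule am"
    and "\<eta> \<in> prob_simplex" and "q \<in> prob_simplex"
  shows "psi_lower L (cw_regret C am \<eta> q / (1 \<bullet> cost_transformed_vec C \<eta>))
           \<le> regret (cost_transformed_loss C L) \<eta> q / ereal (1 \<bullet> cost_transformed_vec C \<eta>)"
proof -
  define S where "S = 1 \<bullet> cost_transformed_vec C \<eta>"
  have S_sum: "S = (\<Sum>j\<in>UNIV. cost_transformed_vec C \<eta> $ j)"
    by (simp add: S_def inner_vec_def)
  have S: "0 < S"
    unfolding S_sum by (rule cost_transformed_vec_sum_pos[OF assms(2,5)])
  \<comment> \<open>This normalized vector turns the cost-weighted problem at \<eta> into a zero-one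
    problem at \<open>e\<close>, with all regrets scaled by \<open>S\<close>.\<close>
  define e where "e = (1 / S) *\<^sub>R cost_transformed_vec C \<eta>"
  have eq: "cost_transformed_vec C \<eta> = S *\<^sub>R e" using S by (simp add: e_def)
  have e: "e \<in> prob_simplex"
    using S cost_transformed_vec_nonneg[OF assms(2,5)]
    by (simp add: prob_simplex_def e_def S_sum flip: sum_divide_distrib)
  obtain j where j: "\<And>l. e $ l \<le> e $ j"
  proof -
    have "Max (range (($) e)) \<in> range (($) e)" by (intro Max_in) auto
    then obtain j where "Max (range (($) e)) = e $ j" by blast
    then have "e $ l \<le> e $ j" for l by (metis Max_ge finite finite_imageI rangeI)
    then show ?thesis using that by blast
  qed
  have "cw_regret C am \<eta> q / S = e $ j - e $ am q"
    using S j by (subst cw_regret_eq[OF assms(2), of \<eta> j]) (auto simp: eq diff_divide_distrib)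
  moreover have "psi_lower L (e $ j - e $ am q) \<le> regret L e q"
    using assms(4) by (intro psi_lower_zero_one[OF assms(1,3) e assms(6) j]) (simp add: argmax_rule_def)
  moreover have "regret (cost_transformed_loss C L) \<eta> q / ereal S = regret L e q"
    using S by (cases "regret L e q")
      (simp_all add: regret_cost_transformed[OF assms(2,5,6,3) S e eq])
  ultimately show ?thesis by (simp add: S_def)
qed

end
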